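(* Let $m$ be a nonnegative integer and $x$ an indeterminate. Then, as formal power series in $u$ (with coefficients that are polynomials in $x$), \[ \sum_{k=0}^\infty \frac{(x+k)^{m+k}}{k!}e^{-u(x+k)} u^k = \sum_{k=0}^m\sum_{i=0}^{m-k}\binom{m+k}{i}\left\{ {m+k-i \atop k} \right\}_{\geq 2}\,\frac{x^i u^{k}}{(1-u)^{m+k+1}}. \]
   Context: For integers $n,k\ge 0$, the 2-associated Stirling subset number $\left\{ {n \atop k} \right\}_{\geq 2}$ is the number of partitions of an $n$-element set into $k$ blocks each of which has at least two elements; in particular it is $0$ if $2k>n$, and by convention $\left\{ {0 \atop k} \right\}_{\geq 2}=\delta_{0k}$. Here $e^{-u(x+k)}$ means $\sum_{\ell\ge0}(-1)^\ell (x+k)^\ell u^\ell/\ell!$ and $(1-u)^{-N}$ is expanded as a power series in $u$. *)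

theory Defs
  imports
    "HOL-Computational_Algebra.Computational_Algebra"
    "HOL-Library.Disjoint_Sets"
begin

definition assoc_stirling2 :: "nat \<Rightarrow> nat \<Rightarrow> nat" where
  "assoc_stirling2 n k =
     card {P. partition_on {..<n} P \<and> card P = k \<and> (\<forall>B\<in>P. 2 \<le> card B)}"

abbreviation polyX :: "rat poly" where
  "polyX \<equiv> [:0, 1:]"

text \<open>
  \<open>fps_exp\<close> and the inverse on \<open>fps\<close> require coefficients with an inverse operation, which
  polynomials lack; hence the following two definitions over the coefficient ring of
  rational polynomials. The variable \<open>u\<close> of the power series is \<open>fps_X\<close>.
\<close>

definition exp_neg_u :: "rat poly \<Rightarrow> rat poly fps" where
  "exp_neg_u p = Abs_fps (\<lambda>l. smult (1 / fact l) ((-1) ^ l * p ^ l))"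

definition one_minus_u_inverse_power :: "nat \<Rightarrow> rat poly fps" where
  "one_minus_u_inverse_power N = fps_right_inverse ((1 - fps_X) ^ N) 1"

lemma one_minus_u_inverse_power:
  "(1 - fps_X) ^ N * one_minus_u_inverse_power N = 1"
  unfolding one_minus_u_inverse_power_def
  by (rule fps_right_inverse) (simp add: fps_nth_power_0)

lemma assoc_stirling2_0_left: "assoc_stirling2 0 k = (if k = 0 then 1 else 0)"
proof -
  have "{P. partition_on {..<0::nat} P \<and> card P = k \<and> (\<forall>B\<in>P. 2 \<le> card B)} =
        (if k = 0 then {{}} else {})"
    by (auto simp: partition_on_empty)
  thus ?thesis by (simp add: assoc_stirling2_def)
qed

end

theory Submission
  imports Defs
begin

text \<open>
  The coefficient of \<open>u^n\<close> on the left is the \<open>n\<close>-th finite difference of \<open>x^(m+n)\<close> divided by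
  \<open>n!\<close>; expanding in powers of \<open>x\<close>, the coefficient of \<open>x^i\<close> is \<open>binomial(m+n, i)\<close> times the
  ordinary Stirling subset number of \<open>m+n-i\<close> and \<open>n\<close>, whose exponential generating function is
  \<open>(e^z - 1)^n / n!\<close>. Writing \<open>e^z - 1 = (e^z - 1 - z) + z\<close> and expanding binomially splits off the
  singleton blocks and expresses it through 2-associated numbers, whose generating function is
  \<open>(e^z - 1 - z)^k / k!\<close>. The trinomial revision of the binomial coefficients then gives the
  coefficient of \<open>u^n\<close> on the right.
\<close>

section \<open>Partitions with blocks of size at least two, on arbitrary sets\<close>

definition partitions_ge2 :: "'a set \<Rightarrow> nat \<Rightarrow> 'a set set set" where
  "partitions_ge2 A k = {P. partition_on A P \<and> card P = k \<and> (\<forall>B\<in>P. 2 \<le> card B)}"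

lemma finite_partitions_ge2:
  assumes "finite A"
  shows "finite (partitions_ge2 A k)"
  by (rule finite_subset[OF _ finitely_many_partition_on[OF assms]])
    (auto simp: partitions_ge2_def)

lemma partitions_ge2_subset_Pow: "partitions_ge2 A k \<subseteq> Pow (Pow A)"
  by (auto simp: partitions_ge2_def partition_on_def)

text \<open>Taking images twice along an injective \<open>f\<close> is injective on the double power
  set and preserves block sizes. An inequality suffices, since it will be applied to a bijection and
  to its inverse.\<close>

lemma card_partitions_ge2_le_image:
  assumes "finite A" and f: "inj_on f A"
  shows "card (partitions_ge2 A k) \<le> card (partitions_ge2 (f ` A) k)"
proof (rule card_inj_on_le)
  have inj: "inj_on ((`) ((`) f)) (Pow (Pow A))"
    by (intro inj_on_image_Pow f)
  thus "inj_on ((`) ((`) f)) (partitions_ge2 A k)"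
    by (rule inj_on_subset) (rule partitions_ge2_subset_Pow)
  show "(`) ((`) f) ` partitions_ge2 A k \<subseteq> partitions_ge2 (f ` A) k"
  proof (rule image_subsetI)
    fix P assume "P \<in> partitions_ge2 A k"
    hence P: "partition_on A P" "card P = k" "\<forall>B\<in>P. 2 \<le> card B"
      by (auto simp: partitions_ge2_def)
    have sub: "P \<subseteq> Pow A" using P(1) by (auto simp: partition_on_def)
    have "{} \<notin> (`) f ` P" using partition_onD3[OF P(1)] by auto
    hence "partition_on (f ` A) ((`) f ` P)"
      using partition_on_inj_image[OF P(1) f] by simp
    moreover have "card ((`) f ` P) = k"
      using card_image[OF inj_on_subset[OF inj_on_image_Pow[OF f] sub]] P(2) by simp
    moreover have "card (f ` B) = card B" if "B \<in> P" for B
      by (rule card_image[OF inj_on_subset[OF f]]) (use sub that in auto)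
    ultimately show "(`) f ` P \<in> partitions_ge2 (f ` A) k"
      using P(3) by (auto simp: partitions_ge2_def)
  qed
  show "finite (partitions_ge2 (f ` A) k)"
    using assms(1) by (intro finite_partitions_ge2) auto
qed

text \<open>Removing a block from a partition of \<open>{..<n}\<close> leaves a set that need not be
  an initial segment. This lets the recurrence count the partitions of what remains.\<close>

lemma card_partitions_ge2:
  assumes "finite A"
  shows "card (partitions_ge2 A k) = assoc_stirling2 (card A) k"
proof -
  obtain f where f: "bij_betw f A {..<card A}"
    using assms bij_betw_iff_card[OF assms finite_lessThan] by auto
  let ?g = "inv_into A f"
  have g: "bij_betw ?g {..<card A} A"
    using f by (rule bij_betw_inv_into)
  have "card (partitions_ge2 A k) \<le> card (partitions_ge2 {..<card A} k)"
    using card_partitions_ge2_le_image[of A f k] assms f by (simp add: bij_betw_def)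
  moreover have "card (partitions_ge2 {..<card A} k) \<le> card (partitions_ge2 A k)"
    using card_partitions_ge2_le_image[of "{..<card A}" ?g k] g by (simp add: bij_betw_def)
  ultimately show ?thesis
    by (simp add: assoc_stirling2_def partitions_ge2_def)
qed

text \<open>Split by the block containing \<open>a\<close>, written \<open>insert a B\<close>. The
  size condition on that block says exactly that \<open>B\<close> is nonempty, and the other blocks
  partition \<open>A - B\<close>.\<close>

lemma partitions_ge2_insert:
  assumes "finite A" "a \<notin> A"
  shows "partitions_ge2 (insert a A) (Suc k) =
    (\<Union>B\<in>Pow A - {{}}. insert (insert a B) ` partitions_ge2 (A - B) k)"
proof (intro equalityI subsetI)
  fix P assume "P \<in> partitions_ge2 (insert a A) (Suc k)"
  hence P: "partition_on (insert a A) P" "card P = Suc k" "\<forall>B\<in>P. 2 \<le> card B"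
    by (auto simp: partitions_ge2_def)
  from P(1) obtain C where C: "C \<in> P" "a \<in> C" by (auto simp: partition_on_def)
  define B where "B = C - {a}"
  define Q where "Q = P - {C}"
  have PQ: "P = insert C Q" and CB: "C = insert a B" and aB: "a \<notin> B" and CQ: "C \<notin> Q"
    using C by (auto simp: B_def Q_def)
  have BA: "B \<subseteq> A" using C(1) P(1) by (auto simp: B_def partition_on_def)
  have "B \<noteq> {}" using P(3) C(1) CB by auto
  have "disjnt C (\<Union>Q)"
    using P(1) C(1) by (auto simp: Q_def partition_on_def disjoint_def disjnt_def)
  hence "partition_on (insert a A - C) Q"
    using P(1) unfolding PQ by (simp add: partition_on_insert)
  moreover have "insert a A - C = A - B" using assms(2) CB by auto
  moreover have "finite P" using P(2) by (intro card_ge_0_finite) simp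
  hence "card Q = k" using P(2) C(1) by (simp add: Q_def)
  ultimately have "Q \<in> partitions_ge2 (A - B) k"
    using P(3) by (auto simp: partitions_ge2_def Q_def)
  thus "P \<in> (\<Union>B\<in>Pow A - {{}}. insert (insert a B) ` partitions_ge2 (A - B) k)"
    using PQ CB BA \<open>B \<noteq> {}\<close> by blast
next
  fix P assume "P \<in> (\<Union>B\<in>Pow A - {{}}. insert (insert a B) ` partitions_ge2 (A - B) k)"
  then obtain B Q where BQ: "B \<subseteq> A" "B \<noteq> {}" "P = insert (insert a B) Q"
    and Q: "partition_on (A - B) Q" "card Q = k" "\<forall>B\<in>Q. 2 \<le> card B"
    by (auto simp: partitions_ge2_def)
  have U: "\<Union>Q = A - B" using Q(1) by (auto simp: partition_on_def)
  have d: "disjnt (insert a B) (\<Union>Q)" using U assms(2) by (auto simp: disjnt_def)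
  have "insert a A - insert a B = A - B" using assms(2) by auto
  hence "partition_on (insert a A) P"
    using partition_on_insert[OF d] Q(1) BQ by auto
  moreover have "finite Q" using Q(1) assms(1) finite_elements by blast
  moreover have "insert a B \<notin> Q" using U assms(2) by auto
  moreover have "finite B" "a \<notin> B" using BQ(1) assms finite_subset by auto
  hence "2 \<le> card (insert a B)"
    using BQ(2) by (simp add: Suc_le_eq card_gt_0_iff)
  ultimately show "P \<in> partitions_ge2 (insert a A) (Suc k)"
    using Q BQ by (auto simp: partitions_ge2_def)
qed

text \<open>Mark the element \<open>n\<close> and group the partitions by the number
  \<open>j\<close> of its companions in its block. The sum starts at 1 because singleton blocks are
  forbidden.\<close>

lemma assoc_stirling2_Suc_Suc:
  "assoc_stirling2 (Suc n) (Suc k) =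
     (\<Sum>j=1..n. (n choose j) * assoc_stirling2 (n - j) k)"
proof -
  let ?A = "{..<n}"
  let ?F = "\<lambda>B. insert (insert n B) ` partitions_ge2 (?A - B) k"
  have notin: "insert n B \<notin> P" if "P \<in> partitions_ge2 (?A - B) k" for B :: "nat set" and P
    using that by (auto simp: partitions_ge2_def partition_on_def)
  have notin': "n \<notin> C" if "P \<in> partitions_ge2 (?A - B) k" "C \<in> P" for B C :: "nat set" and P
    using that by (auto simp: partitions_ge2_def partition_on_def)
  have inj: "inj_on (insert (insert n B)) (partitions_ge2 (?A - B) k)" for B
    using notin by (intro inj_onI) (metis insert_ident)
  have disj: "?F B \<inter> ?F C = {}" if "B \<subseteq> ?A" "C \<subseteq> ?A" "B \<noteq> C" for B C
  proof -
    have False if P: "P \<in> partitions_ge2 (?A - B) k" and Q: "Q \<in> partitions_ge2 (?A - C) k"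
      and eq: "insert (insert n B) P = insert (insert n C) Q" for P Q
    proof -
      have "insert n B \<in> insert (insert n C) Q" using eq by blast
      \<comment> \<open>No block of \<open>Q\<close> contains \<open>n\<close>, so the block of
        \<open>n\<close> can be read off from the partition.\<close>
      hence "insert n B = insert n C" using notin'[OF Q] by blast
      moreover have "n \<notin> B" "n \<notin> C" using \<open>B \<subseteq> ?A\<close> \<open>C \<subseteq> ?A\<close> by auto
      ultimately show False using \<open>B \<noteq> C\<close> by (metis insert_ident)
    qed
    thus ?thesis by blast
  qed
  have card_F: "card (?F B) = assoc_stirling2 (n - card B) k" if "B \<subseteq> ?A" for B
  proof -
    have "card (?F B) = card (partitions_ge2 (?A - B) k)"
      by (rule card_image[OF inj])
    also have "\<dots> = assoc_stirling2 (n - card B) k"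
      using that finite_subset[OF that] by (simp add: card_partitions_ge2 card_Diff_subset)
    finally show ?thesis .
  qed
  have "assoc_stirling2 (Suc n) (Suc k) = card (partitions_ge2 (insert n ?A) (Suc k))"
    by (subst card_partitions_ge2) auto
  also have "\<dots> = card (\<Union>B\<in>Pow ?A - {{}}. ?F B)"
    by (subst partitions_ge2_insert) auto
  also have "\<dots> = (\<Sum>B\<in>Pow ?A - {{}}. card (?F B))"
    by (rule card_UN_disjoint) (use disj in \<open>auto intro!: finite_imageI finite_partitions_ge2\<close>)
  also have "\<dots> = (\<Sum>B\<in>Pow ?A - {{}}. assoc_stirling2 (n - card B) k)"
    using card_F by (intro sum.cong) auto
  also have "\<dots> = (\<Sum>j\<in>{1..n}. \<Sum>B\<in>{B \<in> Pow ?A - {{}}. card B = j}.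
      assoc_stirling2 (n - card B) k)"
  proof (rule sum.group[symmetric])
    show "card ` (Pow ?A - {{}}) \<subseteq> {1..n}"
    proof (rule image_subsetI)
      fix B assume B: "B \<in> Pow ?A - {{}}"
      hence "finite B" using finite_subset by blast
      thus "card B \<in> {1..n}"
        using B card_mono[of ?A B] by (auto simp: Suc_le_eq card_gt_0_iff)
    qed
  qed auto
  also have "\<dots> = (\<Sum>j=1..n. (n choose j) * assoc_stirling2 (n - j) k)"
  proof (rule sum.cong)
    fix j assume "j \<in> {1..n}"
    hence "{B \<in> Pow ?A - {{}}. card B = j} = {B. B \<subseteq> ?A \<and> card B = j}" by auto
    moreover have "card {B. B \<subseteq> ?A \<and> card B = j} = n choose j"
      using n_subsets[of ?A j] by simp
    ultimately show "(\<Sum>B\<in>{B \<in> Pow ?A - {{}}. card B = j}. assoc_stirling2 (n - card B) k)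
        = (n choose j) * assoc_stirling2 (n - j) k" by simp
  qed simp
  finally show ?thesis .
qed

section \<open>Boundary values and generating functions\<close>

lemma assoc_stirling2_0_right: "assoc_stirling2 n 0 = (if n = 0 then 1 else 0)"
proof (cases "n = 0")
  case False
  have "P = {}" if "partition_on {..<n} P" "card P = 0" for P
    using that finite_elements[of "{..<n}" P] by simp
  hence "{P. partition_on {..<n} P \<and> card P = 0 \<and> (\<forall>B\<in>P. 2 \<le> card B)} = {}"
    using False by (auto simp: partition_on_def)
  thus ?thesis using False by (simp only: assoc_stirling2_def card.empty if_False)
qed (simp add: assoc_stirling2_0_left)

lemma assoc_stirling2_eq_0:
  assumes "n < 2 * k"
  shows "assoc_stirling2 n k = 0"
proof -
  have False if P: "partition_on {..<n} P" "card P = k" "\<forall>B\<in>P. 2 \<le> card B" for P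
  proof -
    have "n = (\<Sum>B\<in>P. card B)"
      using product_partition[OF P(1)] P(3) by (force intro: card_ge_0_finite)
    moreover have "(\<Sum>B\<in>P. 2) \<le> (\<Sum>B\<in>P. card B)"
      using P(3) by (intro sum_mono) auto
    ultimately show False using assms P(2) by simp
  qed
  hence "{P. partition_on {..<n} P \<and> card P = k \<and> (\<forall>B\<in>P. 2 \<le> card B)} = {}" by blast
  thus ?thesis by (simp only: assoc_stirling2_def card.empty)
qed

text \<open>By induction on \<open>k\<close>: for \<open>Suc k\<close> both sides have constant term
  0 and the same derivative. The recurrence is a convolution with e^z - 1, which is also the
  derivative of e^z - 1 - z.\<close>

lemma assoc_stirling2_egf:
  "Abs_fps (\<lambda>n. of_nat (assoc_stirling2 n k) / fact n) =
     fps_const (1 / fact k) * (fps_exp 1 - 1 - fps_X :: 'a::field_char_0 fps) ^ k"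
proof (induction k)
  case 0
  show ?case by (auto simp: fps_eq_iff assoc_stirling2_0_right)
next
  case (Suc k)
  let ?E = "\<lambda>k. Abs_fps (\<lambda>n. of_nat (assoc_stirling2 n k) / fact n) :: 'a fps"
  let ?f = "fps_exp 1 - 1 - fps_X :: 'a fps"
  have "fps_deriv (?E (Suc k)) = (fps_exp 1 - 1) * ?E k"
  proof (rule fps_ext)
    fix n
    have "fps_deriv (?E (Suc k)) $ n = of_nat (assoc_stirling2 (Suc n) (Suc k)) / fact n"
      by (simp add: field_simps del: of_nat_Suc)
    also have "\<dots> = (\<Sum>j=1..n. of_nat (n choose j) * of_nat (assoc_stirling2 (n - j) k) / fact n)"
      by (simp add: assoc_stirling2_Suc_Suc sum_divide_distrib)
    also have "\<dots> = (\<Sum>j=1..n. (fps_exp 1 - 1 :: 'a fps) $ j * ?E k $ (n - j))"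
      by (intro sum.cong) (auto simp: binomial_fact)
    also have "\<dots> = (\<Sum>j=0..n. (fps_exp 1 - 1 :: 'a fps) $ j * ?E k $ (n - j))"
      \<comment> \<open>The term \<open>j = 0\<close> is harmless because e^z - 1 has no constant
        term.\<close>
      by (intro sum.mono_neutral_left) (auto simp: not_less_eq_eq)
    also have "\<dots> = ((fps_exp 1 - 1) * ?E k) $ n" by (simp add: fps_mult_nth)
    finally show "fps_deriv (?E (Suc k)) $ n = ((fps_exp 1 - 1) * ?E k) $ n" .
  qed
  also have "\<dots> = fps_deriv (fps_const (1 / fact (Suc k)) * ?f ^ Suc k)"
  proof -
    have c: "fps_const (1 / fact k :: 'a) = fps_const (1 / fact (Suc k)) * fps_const (of_nat (Suc k))"
      by (simp add: field_simps del: of_nat_Suc)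
    show ?thesis
      unfolding Suc.IH c
      by (simp add: fps_deriv_power mult_ac del: of_nat_Suc fact_Suc power_Suc)
  qed
  finally show ?case
    by (subst (asm) fps_deriv_eq_iff) (simp add: assoc_stirling2_0_left)
qed

text \<open>Both sides are j! times the coefficient of z^j in (e^z - 1)^n, expanded once by e^z and
  -1, once by e^z - 1 - z and z. On the right, \<open>n - k\<close> is the number of singleton
  blocks; if it exceeds \<open>j\<close>, the binomial vanishes, so the truncated subtraction does
  no harm.\<close>

lemma alternating_sum_powers:
  "(\<Sum>k\<le>n. (-1) ^ (n - k) * of_nat (n choose k) * of_nat k ^ j :: 'a::field_char_0) =
     fact n * (\<Sum>k\<le>n. of_nat (j choose (n - k)) * of_nat (assoc_stirling2 (j - (n - k)) k))"
proof -
  let ?f = "fps_exp 1 - 1 - fps_X :: 'a fps"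
  have "(fps_exp 1 - 1 :: 'a fps) ^ n = (fps_exp 1 + - 1) ^ n" by simp
  also have "\<dots> $ j = (\<Sum>k\<le>n. (of_nat (n choose k) * fps_exp 1 ^ k * (- 1 :: 'a fps) ^ (n - k)) $ j)"
    by (subst binomial_ring) (simp add: fps_sum_nth)
  also have "\<dots> = (\<Sum>k\<le>n. (-1) ^ (n - k) * of_nat (n choose k) * of_nat k ^ j / fact j)"
  proof (rule sum.cong)
    fix k
    have "of_nat (n choose k) * fps_exp 1 ^ k * (- 1 :: 'a fps) ^ (n - k) =
        fps_const ((-1) ^ (n - k) * of_nat (n choose k)) * fps_exp (of_nat k)"
      by (simp add: fps_exp_power_mult fps_of_nat mult_ac flip: fps_const_mult fps_const_power fps_const_neg)
    thus "(of_nat (n choose k) * fps_exp 1 ^ k * (- 1 :: 'a fps) ^ (n - k)) $ j =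
        (-1) ^ (n - k) * of_nat (n choose k) * of_nat k ^ j / fact j" by simp
  qed simp
  finally have L: "((fps_exp 1 - 1 :: 'a fps) ^ n) $ j =
      (\<Sum>k\<le>n. (-1) ^ (n - k) * of_nat (n choose k) * of_nat k ^ j) / fact j"
    by (simp add: sum_divide_distrib)
  have f: "?f ^ k = fps_const (fact k) * Abs_fps (\<lambda>n. of_nat (assoc_stirling2 n k) / fact n)" for k
    by (simp add: assoc_stirling2_egf flip: mult.assoc)
  have "(fps_exp 1 - 1 :: 'a fps) ^ n = (?f + fps_X) ^ n" by simp
  also have "\<dots> $ j = (\<Sum>k\<le>n. (of_nat (n choose k) * ?f ^ k * fps_X ^ (n - k)) $ j)"
    by (subst binomial_ring) (simp add: fps_sum_nth)
  also have "\<dots> = (\<Sum>k\<le>n. fact n * (of_nat (j choose (n - k)) *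
      of_nat (assoc_stirling2 (j - (n - k)) k)) / fact j)"
  proof (rule sum.cong)
    fix k assume "k \<in> {..n}"
    hence "k \<le> n" by simp
    have "(of_nat (n choose k) * ?f ^ k * fps_X ^ (n - k)) $ j =
        (if j < n - k then 0 else of_nat (n choose k) * fact k *
          of_nat (assoc_stirling2 (j - (n - k)) k) / fact (j - (n - k)))"
      by (simp only: fps_X_power_mult_right_nth f flip: fps_of_nat) (simp add: mult_ac)
    also have "\<dots> = fact n * (of_nat (j choose (n - k)) *
      of_nat (assoc_stirling2 (j - (n - k)) k)) / fact j"
      using \<open>k \<le> n\<close> by (simp add: binomial_fact field_simps)
    finally show "(of_nat (n choose k) * ?f ^ k * fps_X ^ (n - k)) $ j = fact n *
      (of_nat (j choose (n - k)) * of_nat (assoc_stirling2 (j - (n - k)) k)) / fact j" .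
  qed simp
  finally show ?thesis
    unfolding L by (simp flip: sum_divide_distrib sum_distrib_left)
qed

section \<open>Coefficients of negative powers of 1 - u\<close>

lemma one_minus_X_power_mult_binomial:
  "(1 - fps_X) ^ Suc N * Abs_fps (\<lambda>n. of_nat ((n + N) choose N)) = (1 :: 'a::comm_ring_1 fps)"
proof (induction N)
  case 0
  show ?case by (auto simp: fps_eq_iff algebra_simps)
next
  case (Suc N)
  \<comment> \<open>Multiplying by 1 - u takes backward differences of the coefficients, so this is
    Pascal's rule.\<close>
  have "(1 - fps_X) * Abs_fps (\<lambda>n. of_nat ((n + Suc N) choose Suc N) :: 'a) =
      Abs_fps (\<lambda>n. of_nat ((n + N) choose N))"
  proof (rule fps_ext)
    fix n
    show "((1 - fps_X) * Abs_fps (\<lambda>n. of_nat ((n + Suc N) choose Suc N) :: 'a)) $ n =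
      Abs_fps (\<lambda>n. of_nat ((n + N) choose N)) $ n"
      by (cases n) (simp_all add: left_diff_distrib binomial_eq_0)
  qed
  thus ?case using Suc by (simp add: power_Suc2 mult.assoc del: power_Suc)
qed

text \<open>Two inverses of the same element of a commutative ring agree.\<close>

lemma one_minus_u_inverse_power_nth:
  "one_minus_u_inverse_power (Suc N) $ n = of_nat ((n + N) choose N)"
proof -
  let ?B = "Abs_fps (\<lambda>n. of_nat ((n + N) choose N)) :: rat poly fps"
  let ?I = "one_minus_u_inverse_power (Suc N)"
  have "?I = ?I * ((1 - fps_X) ^ Suc N * ?B)"
    by (simp only: one_minus_X_power_mult_binomial mult_1_right)
  also have "\<dots> = ((1 - fps_X) ^ Suc N * ?I) * ?B" by (simp only: mult_ac)
  also have "\<dots> = ?B" by (simp only: one_minus_u_inverse_power mult_1_left)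
  finally show ?thesis by simp
qed

section \<open>Comparison of the coefficients of u^n\<close>

lemma smult_sum_right: "smult c (\<Sum>i\<in>S. f i) = (\<Sum>i\<in>S. smult c (f i))"
  by (induction S rule: infinite_finite_induct) (simp_all add: smult_add_right)

lemma polyX_add_of_nat_power:
  "(polyX + of_nat k) ^ N =
     (\<Sum>i\<le>N. smult (of_nat (N choose i) * of_nat k ^ (N - i)) (polyX ^ i))"
  by (subst binomial_ring) (simp add: of_nat_poly poly_const_pow mult_ac)

theorem theorem1p1:
  fixes m :: nat
  shows "(\<lambda>k. fps_const (smult (1 / fact k) ((polyX + of_nat k) ^ (m + k)))
                * exp_neg_u (polyX + of_nat k) * fps_X ^ k)
         sums
         (\<Sum>k=0..m. \<Sum>i=0..m-k.
            fps_const (of_nat ((m + k) choose i) * of_nat (assoc_stirling2 (m + k - i) k)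
                       * polyX ^ i)
            * fps_X ^ k * one_minus_u_inverse_power (m + k + 1))"
    (is "?t sums ?R")
proof -
  \<comment> \<open>The factor u^k keeps the terms with k > n out of this coefficient, so the claim
    becomes a family of finite identities.\<close>
  have coeff_eq: "(\<Sum>k\<le>n. ?t k $ n) = ?R $ n" for n
  proof -
    define N where "N = m + n"
    \<comment> \<open>The contribution of \<open>k\<close> to the coefficient of x^i u^n, with
      \<open>n - k\<close> singleton blocks. The value 0 for k > n allows the range of
      \<open>k\<close> to be extended past \<open>n\<close>.\<close>
    define c :: "nat \<Rightarrow> nat \<Rightarrow> rat" where "c = (\<lambda>k i. if k \<le> n then
      of_nat (N choose i) * (of_nat ((N - i) choose (n - k)) *
      of_nat (assoc_stirling2 (N - i - (n - k)) k)) else 0)"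
    \<comment> \<open>This produces the bounds k \<le> m and i \<le> m - k: either m + k - i
      elements are too few for \<open>k\<close> blocks of size two, or k > n, or one of the
      binomials vanishes.\<close>
    have c0: "c k i = 0" if "m < k + i" for k i
    proof (cases "k \<le> n \<and> i \<le> m + k")
      case True
      hence "N - i - (n - k) < 2 * k" using that by (auto simp: N_def)
      thus ?thesis by (simp add: c_def assoc_stirling2_eq_0)
    next
      case False
      hence "k \<le> n \<Longrightarrow> N - i < n - k \<or> N < i" by (auto simp: N_def)
      thus ?thesis by (auto simp: c_def)
    qed
    have "(\<Sum>k\<le>n. ?t k $ n) =
        (\<Sum>k\<le>n. smult ((-1) ^ (n - k) * of_nat (n choose k) / fact n) ((polyX + of_nat k) ^ N))"
    proof (rule sum.cong)
      fix k assume "k \<in> {..n}"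
      hence k: "k \<le> n" by simp
      let ?p = "polyX + of_nat k"
      have "?t k $ n = smult (1 / fact k) (?p ^ (m + k)) *
          smult (1 / fact (n - k)) ((-1) ^ (n - k) * ?p ^ (n - k))"
        using k by (simp add: fps_X_power_mult_right_nth exp_neg_u_def)
      also have "(-1) ^ (n - k) * ?p ^ (n - k) = smult ((-1) ^ (n - k)) (?p ^ (n - k))"
        by (cases "even (n - k)") simp_all
      also have "smult (1 / fact k) (?p ^ (m + k)) * smult (1 / fact (n - k)) \<dots> =
          smult ((-1) ^ (n - k) / (fact k * fact (n - k))) (?p ^ (m + k) * ?p ^ (n - k))"
        by (simp add: mult_ac)
      also have "?p ^ (m + k) * ?p ^ (n - k) = ?p ^ N"
        using k by (simp add: N_def flip: power_add)
      also have "(-1) ^ (n - k) / (fact k * fact (n - k)) =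
          (-1) ^ (n - k) * of_nat (n choose k) / (fact n :: rat)"
        using k by (simp add: binomial_fact)
      finally show "?t k $ n =
          smult ((-1) ^ (n - k) * of_nat (n choose k) / fact n) (?p ^ N)" .
    qed simp
    \<comment> \<open>After the binomial expansion, the inner sum is the alternating sum of powers
      with exponent \<open>N - i\<close>.\<close>
    also have "\<dots> = (\<Sum>i\<le>N. \<Sum>k\<le>n. smult (of_nat (N choose i) / fact n *
        ((-1) ^ (n - k) * of_nat (n choose k) * of_nat k ^ (N - i))) (polyX ^ i))"
      unfolding polyX_add_of_nat_power smult_sum_right
      by (subst sum.swap) (simp add: mult_ac)
    also have "\<dots> = (\<Sum>i\<le>N. \<Sum>k\<le>n. smult (c k i) (polyX ^ i))"
    proof (rule sum.cong)
      fix i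
      show "(\<Sum>k\<le>n. smult (of_nat (N choose i) / fact n *
        ((-1) ^ (n - k) * of_nat (n choose k) * of_nat k ^ (N - i))) (polyX ^ i)) =
        (\<Sum>k\<le>n. smult (c k i) (polyX ^ i))"
        unfolding smult_sum[symmetric] sum_distrib_left[symmetric] alternating_sum_powers
        by (simp add: c_def sum_distrib_left)
    qed simp
    also have "\<dots> = (\<Sum>k\<le>n. \<Sum>i\<le>N. smult (c k i) (polyX ^ i))"
      by (rule sum.swap)
    \<comment> \<open>As \<open>m\<close> and \<open>n\<close> are not ordered, the range of
      \<open>k\<close> is first enlarged to \<open>N\<close>, which bounds both, and then cut down
      to \<open>m\<close>.\<close>
    also have "\<dots> = (\<Sum>k\<le>N. \<Sum>i\<le>N. smult (c k i) (polyX ^ i))"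
      by (rule sum.mono_neutral_left) (auto simp: N_def c_def)
    also have "\<dots> = (\<Sum>k=0..m. \<Sum>i\<le>N. smult (c k i) (polyX ^ i))"
      by (rule sum.mono_neutral_right) (auto simp: N_def c0)
    also have "\<dots> = (\<Sum>k=0..m. \<Sum>i=0..m-k. smult (c k i) (polyX ^ i))"
      by (intro sum.cong sum.mono_neutral_right) (auto simp: N_def intro!: c0)
    also have "\<dots> = ?R $ n"
      unfolding fps_sum_nth
    proof (intro sum.cong)
      fix k i assume "k \<in> {0..m}" "i \<in> {0..m-k}"
      hence ki: "k \<le> m" "i + k \<le> m" by auto
      show "smult (c k i) (polyX ^ i) =
        (fps_const (of_nat ((m + k) choose i) * of_nat (assoc_stirling2 (m + k - i) k)
                       * polyX ^ i)
            * fps_X ^ k * one_minus_u_inverse_power (m + k + 1)) $ n" (is "_ = ?r $ n")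
      proof (cases "k \<le> n")
        case True
        have "?r = fps_const (of_nat ((m + k) choose i) * of_nat (assoc_stirling2 (m + k - i) k)
             * polyX ^ i) * (fps_X ^ k * one_minus_u_inverse_power (Suc (m + k)))"
          by (simp add: mult.assoc)
        also have "\<dots> $ n = of_nat (((m + k) choose i) * assoc_stirling2 (m + k - i) k *
            (N choose (m + k))) * polyX ^ i"
          using True by (simp add: fps_X_power_mult_nth one_minus_u_inverse_power_nth N_def
              ac_simps)
        also have "((m + k) choose i) * assoc_stirling2 (m + k - i) k * (N choose (m + k)) =
            (N choose i) * ((N - i) choose (n - k)) * assoc_stirling2 (N - i - (n - k)) k"
        proof -
          \<comment> \<open>Trinomial revision; passing to the complement turns
            \<open>m + k - i\<close> into \<open>n - k\<close>, since N - i is the sum of these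
            two.\<close>
          have "(N choose (m + k)) * ((m + k) choose i) =
              (N choose i) * ((N - i) choose (m + k - i))"
            using True ki by (intro choose_mult) (auto simp: N_def)
          also have "(N - i) choose (m + k - i) = (N - i) choose (n - k)"
            using True ki by (subst binomial_symmetric) (auto simp: N_def)
          moreover have "N - i - (n - k) = m + k - i" using True ki by (simp add: N_def)
          ultimately show ?thesis by (simp add: mult_ac)
        qed
        also have "of_nat \<dots> * polyX ^ i = smult (c k i) (polyX ^ i)"
          using True by (simp add: c_def of_nat_poly mult_ac)
        finally show ?thesis ..
      next
        case False
        have "?r = fps_X ^ k * (fps_const (of_nat ((m + k) choose i) *
            of_nat (assoc_stirling2 (m + k - i) k) * polyX ^ i) *
            one_minus_u_inverse_power (m + k + 1))"
          by (simp only: mult_ac)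
        thus ?thesis using False by (simp only: fps_X_power_mult_nth) (simp add: c_def)
      qed
    qed auto
    finally show ?thesis .
  qed
  show ?thesis
    unfolding sums_def
  \<comment> \<open>Convergence of formal power series means that each coefficient is eventually
    constant; that of u^n is so as soon as K > n.\<close>
  proof (rule tendsto_fpsI)
    fix n
    show "\<forall>\<^sub>F K in sequentially. (\<Sum>k<K. ?t k) $ n = ?R $ n"
      using eventually_gt_at_top[of n]
    proof eventually_elim
      case (elim K)
      have "(\<Sum>k<K. ?t k) $ n = (\<Sum>k\<le>n. ?t k $ n)"
        unfolding fps_sum_nth using elim
        by (intro sum.mono_neutral_right) (auto simp: fps_X_power_mult_right_nth)
      thus ?case by (simp only: coeff_eq)
    qed
  qed
qed

end
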